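(* Let $\lambda\in\mathbb{R}$, let $\alpha>0$, and let $X_\lambda$ be a degenerate zero-truncated Poisson random variable with parameter $\alpha$. Then, for $\lambda\neq-\frac1\alpha$, the expectation of $X_\lambda$ is given by $$E[X_\lambda]=\frac{\alpha}{1+\alpha\lambda}\,\frac{e_\lambda(\alpha)}{e_\lambda(\alpha)-1}=\frac{\alpha}{1+\alpha\lambda}\,\frac{1}{1-e_\lambda^{-1}(\alpha)}.$$
   Context: For real $x,\lambda$ the $\lambda$-falling factorials are $(x)_{0,\lambda}=1$ and $(x)_{n,\lambda}=x(x-\lambda)(x-2\lambda)\cdots(x-(n-1)\lambda)$ for $n\ge1$. The degenerate exponential is $e_\lambda^x(t)=(1+\lambda t)^{x/\lambda}=\sum_{n=0}^\infty (x)_{n,\lambda}\frac{t^n}{n!}$ (for $\lambda=0$ it is understood as the limit $e^{xt}$), with $e_\lambda(t)=e_\lambda^1(t)$ and $e_\lambda^{-1}(t)=1/e_\lambda(t)$. A random variable $X_\lambda$ taking values in $\{1,2,3,\dots\}$ is a degenerate zero-truncated Poisson random variable with parameter $\alpha>0$ if its probability mass function is $$P_\lambda(n)=P\{X_\lambda=n\}=\frac{1}{e_\lambda(\alpha)-1}\,\frac{\alpha^n}{n!}\,(1)_{n,\lambda},\qquad n=1,2,3,\dots$$ As part of this definition, $\lambda$ and $\alpha$ are such that this formula is meaningful and is a probability mass function (the values are nonnegative, and the series $\sum_{n\ge 0}(1)_{n,\lambda}\alpha^n/n!$ converges to $e_\lambda(\alpha)$, so that the values sum to $1$). *)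

theory Defs
  imports "HOL-Probability.Probability"
begin

definition deg_ffact :: "real \<Rightarrow> real \<Rightarrow> nat \<Rightarrow> real" where
  "deg_ffact lam x n = (\<Prod>i<n. x - real i * lam)"

(* e_lam^x(t); the case lam = 0 is the limit of (1 + lam * t) powr (x / lam) as lam tends to 0. *)
definition deg_exp :: "real \<Rightarrow> real \<Rightarrow> real \<Rightarrow> real" where
  "deg_exp lam x t = (if lam = 0 then exp (x * t) else (1 + lam * t) powr (x / lam))"

lemma deg_exp_minus_one: "deg_exp lam (- 1) t = 1 / deg_exp lam 1 t"
  by (simp add: deg_exp_def exp_minus powr_minus divide_inverse)

definition deg_zt_poisson_mass :: "real \<Rightarrow> real \<Rightarrow> nat \<Rightarrow> real" where
  "deg_zt_poisson_mass lam alpha n =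
     1 / (deg_exp lam 1 alpha - 1) * (alpha ^ n / fact n) * deg_ffact lam 1 n"

(* The nonnegativity and sums conditions restrict lam and alpha to the values for which the
   mass formula is a probability mass function. *)
definition deg_zt_poisson ::
    "'a measure \<Rightarrow> ('a \<Rightarrow> nat) \<Rightarrow> real \<Rightarrow> real \<Rightarrow> bool" where
  "deg_zt_poisson M X lam alpha \<longleftrightarrow>
     alpha > 0 \<and>
     (\<forall>n\<ge>1. deg_zt_poisson_mass lam alpha n \<ge> 0) \<and>
     (\<lambda>n. deg_ffact lam 1 n * alpha ^ n / fact n) sums deg_exp lam 1 alpha \<and>
     X \<in> measurable M (count_space {1..}) \<and>
     (\<forall>n\<ge>1. measure M {\<omega> \<in> space M. X \<omega> = n} = deg_zt_poisson_mass lam alpha n)"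

end

theory Submission imports Defs begin

text \<open>
  Write \<open>c n\<close> for the \<open>n\<close>-th term of the series of \<open>e = deg_exp lam 1 alpha\<close>; the probability of
  the value \<open>n \<ge> 1\<close> is \<open>c n / (e - 1)\<close>, so the expectation is \<open>(\<Sum>n. n * c n) / (e - 1)\<close>.
  The product defining \<open>c\<close> gives \<open>(n + 1) * c (n + 1) = alpha * (1 - n * lam) * c n\<close>. If \<open>n * c n\<close> is
  summable with sum \<open>S\<close>, summing this recurrence yields \<open>S = alpha * e - alpha * lam * S\<close>, and hence
  \<open>S = alpha * e / (1 + alpha * lam)\<close>.

  What remains is the summability. The total probability is \<open>1\<close>, so \<open>e \<noteq> 1\<close>, and as the mass at \<open>1\<close> is
  nonnegative and \<open>c 1 = alpha > 0\<close>, even \<open>e > 1\<close>; hence all \<open>c n\<close> are nonnegative. Summing the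
  recurrence over \<open>n < N\<close> only gives
  \<open>(1 + alpha * lam) * (\<Sum>n<N. n * c n) + N * c N = alpha * (\<Sum>n<N. c n)\<close>.
  If \<open>1 + alpha * lam > 0\<close>, the right-hand side is at most \<open>alpha * e\<close> and bounds the
  partial sums of \<open>n * c n\<close>. If \<open>1 + alpha * lam < 0\<close>, it implies \<open>N * c N \<ge> alpha\<close> for \<open>N \<ge> 1\<close>, so that
  \<open>c\<close> would dominate a multiple of the harmonic series; the convergence of \<open>c\<close> excludes this case.
\<close>

lemma moment_partial_sum:
  fixes c :: "nat \<Rightarrow> real"
  assumes rec: "\<And>n. real (Suc n) * c (Suc n) = a * (1 - real n * l) * c n"
  shows "(1 + a * l) * (\<Sum>n<N. real n * c n) + real N * c N = a * (\<Sum>n<N. c n)"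
proof (induction N)
  case (Suc N)
  then show ?case
    unfolding rec by (simp add: algebra_simps)
qed simp

text \<open>
  The two signs of \<open>1 + a * l\<close> need different arguments, and only the positive one
  is compatible with the convergence of \<open>c\<close>.
\<close>

lemma moment_summable:
  fixes c :: "nat \<Rightarrow> real"
  assumes rec: "\<And>n. real (Suc n) * c (Suc n) = a * (1 - real n * l) * c n"
    and nonneg: "\<And>n. c n \<ge> 0" and c0: "c 0 > 0" and a: "a > 0"
    and c: "summable c" and nz: "1 + a * l \<noteq> 0"
  shows "summable (\<lambda>n. real n * c n)"
proof (cases "1 + a * l > 0")
  case True
  have "(\<Sum>n<N. real n * c n) \<le> a * suminf c / (1 + a * l)" for N
  proof -
    have "(1 + a * l) * (\<Sum>n<N. real n * c n) \<le> a * (\<Sum>n<N. c n)"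
      using moment_partial_sum[OF rec, of N] nonneg[of N] mult_nonneg_nonneg[of "real N" "c N"]
      by linarith
    also have "\<dots> \<le> a * suminf c"
      using a c nonneg by (intro mult_left_mono sum_le_suminf) auto
    finally show ?thesis
      using True by (simp add: field_simps)
  qed
  then show ?thesis
    by (intro summableI_nonneg_bounded) (auto simp: nonneg)
next
  case False
  with nz have neg: "1 + a * l < 0" by linarith
  have "a * c 0 / real (Suc N) \<le> c (Suc N)" for N
  proof -
    have "(1 + a * l) * (\<Sum>n<Suc N. real n * c n) \<le> 0"
      using neg nonneg by (intro mult_nonpos_nonneg sum_nonneg) auto
    moreover have "c 0 \<le> (\<Sum>n<Suc N. c n)"
      using nonneg by (intro member_le_sum) auto
    then have "a * c 0 \<le> a * (\<Sum>n<Suc N. c n)"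
      using a by simp
    ultimately have "a * c 0 \<le> real (Suc N) * c (Suc N)"
      using moment_partial_sum[OF rec, of "Suc N"] by linarith
    then show ?thesis
      by (simp add: field_simps)
  qed
  moreover have "summable (\<lambda>N. c (Suc N))"
    using c by (simp only: summable_Suc_iff)
  ultimately have "summable (\<lambda>N. a * c 0 / real (Suc N))"
    using a c0 by (intro summable_comparison_test[of "\<lambda>N. a * c 0 / real (Suc N)"])
      (auto simp del: of_nat_Suc intro!: exI[of _ 0])
  then have "summable (\<lambda>N. (a * c 0) * inverse (real (Suc N)))"
    by (simp only: divide_inverse)
  then have "summable (\<lambda>N. inverse (real (Suc N)))"
    using a c0 by (subst (asm) summable_cmult_iff) simp
  then have "summable (\<lambda>n. inverse (real n))"
    by (simp only: summable_Suc_iff[of "\<lambda>n. inverse (real n)"])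
  then show ?thesis
    using not_summable_harmonic[where 'a = real] by simp
qed

lemma moment_sums:
  fixes c :: "nat \<Rightarrow> real"
  assumes rec: "\<And>n. real (Suc n) * c (Suc n) = a * (1 - real n * l) * c n"
    and nonneg: "\<And>n. c n \<ge> 0" and c0: "c 0 > 0" and a: "a > 0"
    and c: "c sums e" and nz: "1 + a * l \<noteq> 0"
  shows "(\<lambda>n. real n * c n) sums (a * e / (1 + a * l))"
proof -
  have "summable (\<lambda>n. real n * c n)"
    using moment_summable[OF rec nonneg c0 a _ nz] c by (auto dest: sums_summable)
  then obtain S where S: "(\<lambda>n. real n * c n) sums S"
    by (auto simp: summable_def)
  then have "(\<lambda>n. real (Suc n) * c (Suc n)) sums S"
    using sums_Suc_iff[of "\<lambda>n. real n * c n" S] by simp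
  moreover have "(\<lambda>n. a * c n - (a * l) * (real n * c n)) sums (a * e - (a * l) * S)"
    by (intro sums_diff sums_mult c S)
  then have "(\<lambda>n. real (Suc n) * c (Suc n)) sums (a * e - (a * l) * S)"
    unfolding rec by (simp add: algebra_simps)
  ultimately have "S = a * e - (a * l) * S"
    by (rule sums_unique2)
  then have "S = a * e / (1 + a * l)"
    using nz by (simp add: field_simps)
  with S show ?thesis by simp
qed

lemma deg_exp_term_rec:
  fixes lam a :: real
  defines "c \<equiv> \<lambda>n. deg_ffact lam 1 n * a ^ n / fact n"
  shows "real (Suc n) * c (Suc n) = a * (1 - real n * lam) * c n"
proof -
  have "deg_ffact lam 1 (Suc n) = deg_ffact lam 1 n * (1 - real n * lam)"
    by (simp add: deg_ffact_def)
  moreover have "real (Suc n) / fact (Suc n) = 1 / fact n"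
    by (simp add: field_simps del: of_nat_Suc)
  ultimately have "real (Suc n) * c (Suc n) =
      deg_ffact lam 1 n * (1 - real n * lam) * a ^ Suc n * (1 / fact n)"
    unfolding c_def by (metis (no_types) mult.commute mult.left_commute times_divide_eq_right)
  then show ?thesis
    by (simp add: c_def mult.commute)
qed

lemma (in prob_space) distr_nat_eq_density:
  fixes X :: "'a \<Rightarrow> nat"
  assumes X: "X \<in> measurable M (count_space UNIV)"
  shows "distr M (count_space UNIV) X =
    density (count_space UNIV) (\<lambda>n. ennreal (prob {\<omega> \<in> space M. X \<omega> = n}))"
proof (rule measure_eqI_countable[where A = UNIV])
  fix n :: nat
  have "X -` {n} \<inter> space M = {\<omega> \<in> space M. X \<omega> = n}" by auto
  then show "emeasure (distr M (count_space UNIV) X) {n} =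
      emeasure (density (count_space UNIV) (\<lambda>n. ennreal (prob {\<omega> \<in> space M. X \<omega> = n}))) {n}"
    using X by (simp add: emeasure_distr emeasure_density emeasure_eq_measure
        nn_integral_count_space_indicator[symmetric])
qed auto

lemma (in prob_space) expectation_nat_sums:
  fixes X :: "'a \<Rightarrow> nat"
  assumes X: "X \<in> measurable M (count_space UNIV)"
    and m: "(\<lambda>n. real n * prob {\<omega> \<in> space M. X \<omega> = n}) sums m"
  shows "integrable M (\<lambda>\<omega>. real (X \<omega>))" and "expectation (\<lambda>\<omega>. real (X \<omega>)) = m"
proof -
  let ?p = "\<lambda>n. prob {\<omega> \<in> space M. X \<omega> = n}"
  have int: "integrable (count_space UNIV) (\<lambda>n. ?p n *\<^sub>R real n)"
    using m by (simp add: integrable_count_space_nat_iff sums_iff mult.commute)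
  have "integrable (distr M (count_space UNIV) X) real"
    unfolding distr_nat_eq_density[OF X] using int by (subst integrable_density) auto
  then show "integrable M (\<lambda>\<omega>. real (X \<omega>))"
    using X by (subst (asm) integrable_distr_eq) auto
  have "expectation (\<lambda>\<omega>. real (X \<omega>)) = integral\<^sup>L (distr M (count_space UNIV) X) real"
    using X by (subst integral_distr) auto
  also have "\<dots> = (LINT n|count_space UNIV. ?p n *\<^sub>R real n)"
    unfolding distr_nat_eq_density[OF X] by (subst integral_density) auto
  also have "\<dots> = m"
    using int m by (simp add: integral_count_space_nat sums_iff mult.commute)
  finally show "expectation (\<lambda>\<omega>. real (X \<omega>)) = m" .
qed

lemma (in prob_space) ex_nat_prob_nonzero:
  fixes X :: "'a \<Rightarrow> nat"
  assumes X: "X \<in> measurable M (count_space UNIV)"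
  shows "\<exists>n. prob {\<omega> \<in> space M. X \<omega> = n} \<noteq> 0"
proof (rule ccontr)
  assume "\<not> ?thesis"
  then have "AE \<omega> in M. X \<omega> \<noteq> n" for n
    using X by (intro AE_I[of _ _ "{\<omega> \<in> space M. X \<omega> = n}"]) (auto simp: emeasure_eq_measure)
  then have "AE \<omega> in M. \<forall>n. X \<omega> \<noteq> n"
    by (subst AE_all_countable) blast
  then show False by simp
qed

theorem theorem2p1:
  fixes M :: "'a measure" and X :: "'a \<Rightarrow> nat" and lam alpha :: real
  assumes "prob_space M"
    and "alpha > 0"
    and "deg_zt_poisson M X lam alpha"
    and "lam \<noteq> - (1 / alpha)"
  shows "integrable M (\<lambda>\<omega>. real (X \<omega>)) \<and>
    prob_space.expectation M (\<lambda>\<omega>. real (X \<omega>)) =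
      alpha / (1 + alpha * lam) * (deg_exp lam 1 alpha / (deg_exp lam 1 alpha - 1)) \<and>
    alpha / (1 + alpha * lam) * (deg_exp lam 1 alpha / (deg_exp lam 1 alpha - 1)) =
      alpha / (1 + alpha * lam) * (1 / (1 - deg_exp lam (- 1) alpha))"
proof -
  interpret prob_space M by fact
  define e where "e = deg_exp lam 1 alpha"
  define c where "c = (\<lambda>n. deg_ffact lam 1 n * alpha ^ n / fact n)"
  have mass: "deg_zt_poisson_mass lam alpha n = c n / (e - 1)" for n
    by (simp add: deg_zt_poisson_mass_def c_def e_def mult.commute)
  have mass_nonneg: "c n / (e - 1) \<ge> 0" if "n \<ge> 1" for n
    using assms(3) that by (auto simp: deg_zt_poisson_def mass)
  have c_sums: "c sums e"
    using assms(3) by (simp add: deg_zt_poisson_def c_def e_def)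
  have X: "X \<in> measurable M (count_space {1..})"
    using assms(3) by (simp add: deg_zt_poisson_def)
  then have X_UNIV: "X \<in> measurable M (count_space UNIV)"
    by (rule measurable_compose[of X M _ "\<lambda>n. n", OF _ measurable_count_space_eq1[THEN iffD2]]) simp
  have prob_pos: "prob {\<omega> \<in> space M. X \<omega> = n} = c n / (e - 1)" if "n \<ge> 1" for n
    using assms(3) that by (simp add: deg_zt_poisson_def mass)
  have "{\<omega> \<in> space M. X \<omega> = 0} = {}"
    using measurable_space[OF X] by fastforce
  then have prob_0: "prob {\<omega> \<in> space M. X \<omega> = 0} = 0"
    by (simp only: measure_empty)

  \<comment> \<open>With \<open>e = 1\<close> the division by zero would make every mass vanish.\<close>
  have "e \<noteq> 1"
  proof
    assume "e = 1"
    then have "prob {\<omega> \<in> space M. X \<omega> = n} = 0" for n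
      using prob_pos[of n] prob_0 by (cases "n = 0") auto
    then show False
      using ex_nat_prob_nonzero[OF X_UNIV] by blast
  qed
  moreover have "c 0 = 1" "c 1 = alpha"
    by (simp_all add: c_def deg_ffact_def)
  ultimately have "e > 1"
    using mass_nonneg[of 1] assms(2) by (auto simp: zero_le_divide_iff)
  have "c n \<ge> 0" for n
    using mass_nonneg[of n] \<open>e > 1\<close> \<open>c 0 = 1\<close>
    by (cases "n = 0") (auto simp: zero_le_divide_iff)
  moreover have nz: "1 + alpha * lam \<noteq> 0"
    using assms(2,4) by (auto simp: field_simps add_eq_0_iff)
  ultimately have "(\<lambda>n. real n * c n) sums (alpha * e / (1 + alpha * lam))"
    using deg_exp_term_rec[of _ lam alpha] c_sums \<open>c 0 = 1\<close> assms(2)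
    unfolding c_def by (intro moment_sums) auto
  then have "(\<lambda>n. real n * c n / (e - 1)) sums (alpha * e / (1 + alpha * lam) / (e - 1))"
    by (rule sums_divide)
  moreover have "real n * c n / (e - 1) = real n * prob {\<omega> \<in> space M. X \<omega> = n}" for n
    using prob_pos[of n] by (cases "n = 0") auto
  ultimately have "(\<lambda>n. real n * prob {\<omega> \<in> space M. X \<omega> = n}) sums
      (alpha / (1 + alpha * lam) * (e / (e - 1)))"
    by simp
  note expectation_nat_sums[OF X_UNIV this]
  moreover have "e / (e - 1) = 1 / (1 - deg_exp lam (- 1) alpha)"
    using \<open>e > 1\<close> by (simp add: deg_exp_minus_one flip: e_def) (simp add: field_simps)
  ultimately show ?thesis
    unfolding e_def by (simp only: simp_thms)
qed

end
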